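(* Let $h:\mathbb{R}^n\to\mathbb{R}$ be a differentiable and strongly quasiconvex function with modulus $\gamma>0$, and let $\overline{x}$ be its minimizer, $\{\overline{x}\}=\operatorname{argmin}_{\mathbb{R}^n}h$. Let $\alpha>0$ and consider the dynamical system $$\ddot x(t)+\alpha\dot x(t)+\nabla h(x(t))=0\quad(t>0),\qquad x(0)=x_0,\quad\dot x(0)=v_0 .$$ Suppose that there exists $\kappa\in\,]0,+\infty[$ such that for every trajectory $x(t)$ of this system $$\langle\nabla h(x(t)),x(t)-\overline{x}\rangle\ge\kappa\,\bigl(h(x(t))-h(\overline{x})\bigr)\quad\text{for all } t.$$ Then any trajectory $x(t)$ generated by this system converges exponentially to $\overline{x}$, the unique minimizer of $h$ on $\mathbb{R}^n$, and the function values $h(x(t))$ converge exponentially to the optimal value $h(\overline{x})$.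
   Context: $\langle\cdot,\cdot\rangle$ and $\|\cdot\|$ denote the Euclidean inner product and norm on $\mathbb{R}^n$. A trajectory is a solution $x:[0,+\infty[\,\to\mathbb{R}^n$ of the system with initial data $x_0,v_0\in\mathbb{R}^n$. A function $h:\mathbb{R}^n\to\mathbb{R}$ is strongly quasiconvex with modulus $\gamma>0$ if for all $x,y\in\mathbb{R}^n$ and all $\lambda\in[0,1]$, $$h(\lambda y+(1-\lambda)x)\le\max\{h(y),h(x)\}-\lambda(1-\lambda)\frac{\gamma}{2}\|x-y\|^2.$$ It is known that a lower semicontinuous strongly quasiconvex function on $\mathbb{R}^n$ has exactly one minimizer. Exponential convergence means: there are constants $C\ge0$, $c>0$ (which may depend on the trajectory) with $\|x(t)-\overline{x}\|\le Ce^{-ct}$, respectively $h(x(t))-h(\overline{x})\le Ce^{-ct}$, for all $t\ge0$. *)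

theory Defs
  imports "HOL-Analysis.Analysis"
begin

definition grad :: "('a::euclidean_space \<Rightarrow> real) \<Rightarrow> 'a \<Rightarrow> 'a" where
  "grad h x = (THE d. GDERIV h x :> d)"

lemma GDERIV_unique:
  fixes h :: "'a::real_inner \<Rightarrow> real"
  assumes "GDERIV h x :> d" "GDERIV h x :> e"
  shows "d = e"
proof -
  have eq: "(\<lambda>u. u \<bullet> d) = (\<lambda>u. u \<bullet> e)"
    using assms unfolding gderiv_def by (rule has_derivative_unique)
  have "u \<bullet> (d - e) = 0" for u
    using fun_cong[OF eq, of u] by (simp add: inner_diff_right)
  from this[of "d - e"] show ?thesis
    by simp
qed

lemma GDERIV_grad:
  fixes h :: "'a::euclidean_space \<Rightarrow> real"
  assumes "h differentiable (at x)"
  shows "GDERIV h x :> grad h x"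
proof -
  obtain f' where f': "(h has_derivative f') (at x)"
    using assms unfolding differentiable_def by blast
  have lin: "linear f'"
    using f' by (rule has_derivative_linear)
  define d where "d = adjoint f' 1"
  have "f' u = u \<bullet> d" for u
    using adjoint_works[OF lin, of u 1] by (simp add: d_def)
  then have eq: "f' = (\<lambda>u. u \<bullet> d)"
    by (rule ext)
  have g: "GDERIV h x :> d"
    using f' unfolding gderiv_def eq .
  show ?thesis
    unfolding grad_def
  proof (rule theI)
    show "GDERIV h x :> d" by (fact g)
  next
    fix e assume "GDERIV h x :> e"
    then show "e = d" using g by (rule GDERIV_unique)
  qed
qed

definition strongly_quasiconvex :: "real \<Rightarrow> ('a::real_normed_vector \<Rightarrow> real) \<Rightarrow> bool" where
  "strongly_quasiconvex \<gamma> h \<longleftrightarrow>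
     \<gamma> > 0 \<and>
     (\<forall>x y. \<forall>s\<in>{0..1}.
        h (s *\<^sub>R y + (1 - s) *\<^sub>R x)
          \<le> max (h y) (h x) - s * (1 - s) * (\<gamma> / 2) * (norm (x - y))\<^sup>2)"

(* x is regarded as a function on the half-line {0..}: its values at negative times are
   irrelevant, and the derivative at time 0 is one-sided. The function v is the velocity of x.
   Solutions are pointwise; h is merely differentiable, so the acceleration need not be
   continuous. *)
definition trajectory ::
    "real \<Rightarrow> ('a::euclidean_space \<Rightarrow> real) \<Rightarrow> 'a \<Rightarrow> 'a \<Rightarrow> (real \<Rightarrow> 'a) \<Rightarrow> bool" where
  "trajectory \<alpha> h x\<^sub>0 v\<^sub>0 x \<longleftrightarrow>
     (\<exists>v a. (\<forall>t\<ge>0. (x has_vector_derivative v t) (at t within {0..})) \<and>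
            (\<forall>t>0. (v has_vector_derivative a t) (at t)) \<and>
            (\<forall>t>0. a t + \<alpha> *\<^sub>R v t + grad h (x t) = 0) \<and>
            x 0 = x\<^sub>0 \<and> v 0 = v\<^sub>0)"

end

theory Submission
  imports Defs
begin

text \<open>
  Write \<open>y = x - xbar\<close>, \<open>H = h x - h xbar\<close> and let \<open>v\<close> be the velocity. The Lyapunov function
  \<open>E = H + |v|\<^sup>2 / 2 + (\<alpha> / 2) \<langle>y, v\<rangle> + (\<alpha>\<^sup>2 / 4) |y|\<^sup>2\<close> satisfies
  \<open>E' = - (\<alpha> / 2) |v|\<^sup>2 - (\<alpha> / 2) \<langle>\<nabla>h x, y\<rangle> \<le> - (\<alpha> / 2) (|v|\<^sup>2 + \<kappa> H)\<close>. Strong quasiconvexity at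
  the midpoint of \<open>x\<close> and \<open>xbar\<close> gives \<open>H \<ge> (\<gamma> / 8) |y|\<^sup>2\<close>, so \<open>E\<close> is dominated by \<open>H + |v|\<^sup>2\<close>
  and hence \<open>E' \<le> - c E\<close> for some \<open>c > 0\<close>. Since \<open>E \<ge> H \<ge> (\<gamma> / 8) |y|\<^sup>2\<close>, both claims follow.
\<close>

text \<open>At the midpoint the modulus enters with weight 1/2 * 1/2 * \<gamma>/2 = \<gamma>/8.
  Minimality is used twice: the maximum equals \<open>h x\<close>, and the midpoint value is at
  least \<open>h xbar\<close>.\<close>

lemma strongly_quasiconvex_quadratic_growth:
  assumes "strongly_quasiconvex \<gamma> h" and min: "\<And>z. h xbar \<le> h z"
  shows "\<gamma> / 8 * (norm (x - xbar))\<^sup>2 \<le> h x - h xbar"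
proof -
  have "h ((1/2) *\<^sub>R xbar + (1 - 1/2) *\<^sub>R x)
      \<le> max (h xbar) (h x) - 1/2 * (1 - 1/2) * (\<gamma> / 2) * (norm (x - xbar))\<^sup>2"
    using assms(1) unfolding strongly_quasiconvex_def
    by (elim conjE allE[of _ x] allE[of _ xbar] ballE[of _ _ "1/2"]) auto
  with min[of "(1/2) *\<^sub>R xbar + (1 - 1/2) *\<^sub>R x"] min[of x] show ?thesis
    by (simp add: max_def field_simps split: if_splits)
qed

text \<open>Gronwall argument: with the integrating factor \<open>exp (c * t)\<close> the product
  \<open>E t * exp (c * t)\<close> has nonpositive derivative on the half-line from
  \<open>a\<close>.\<close>

lemma differential_inequality_exp_decay:
  fixes E E' :: "real \<Rightarrow> real"
  assumes "\<And>t. t \<ge> a \<Longrightarrow> (E has_real_derivative E' t) (at t)"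
    and "\<And>t. t \<ge> a \<Longrightarrow> E' t \<le> - c * E t"
    and "t \<ge> a"
  shows "E t \<le> E a * exp (c * a) * exp (- c * t)"
proof -
  have "E t * exp (c * t) \<le> E a * exp (c * a)"
  proof (rule DERIV_nonpos_imp_nonincreasing[OF \<open>t \<ge> a\<close>])
    fix s assume "a \<le> s"
    then have "((\<lambda>t. E t * exp (c * t)) has_real_derivative
        (E' s + c * E s) * exp (c * s)) (at s)"
      by (auto intro!: derivative_eq_intros assms(1) simp: algebra_simps)
    moreover have "(E' s + c * E s) * exp (c * s) \<le> 0"
      using assms(2)[OF \<open>a \<le> s\<close>] by (intro mult_nonpos_nonneg) auto
    ultimately show "\<exists>y. ((\<lambda>t. E t * exp (c * t)) has_real_derivative y) (at s) \<and> y \<le> 0"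
      by blast
  qed
  then show ?thesis
    by (simp add: exp_minus field_simps)
qed

text \<open>On the compact interval \<open>{0..a}\<close> a bound \<open>M\<close> for
  \<open>f\<close> exists by continuity, and the factor \<open>exp (c * a)\<close> makes up for the
  decay of \<open>exp (- c * t)\<close> before time \<open>a\<close>.\<close>

lemma exp_decay_extend_to_zero:
  fixes f :: "real \<Rightarrow> real"
  assumes cont: "continuous_on {0..a} f" and "c \<ge> 0" "K \<ge> 0"
    and decay: "\<And>t. t \<ge> a \<Longrightarrow> f t \<le> K * exp (- c * t)"
  shows "\<exists>C\<ge>0. \<forall>t\<ge>0. f t \<le> C * exp (- c * t)"
proof -
  have "bounded (f ` {0..a})"
    by (intro compact_imp_bounded compact_continuous_image cont) auto
  then obtain M where "M > 0" and M: "\<And>t. t \<in> {0..a} \<Longrightarrow> norm (f t) \<le> M"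
    by (auto simp: bounded_pos)
  define C where "C = max K (M * exp (c * a))"
  have "f t \<le> C * exp (- c * t)" if "t \<ge> 0" for t
  proof (cases "t \<ge> a")
    case True
    have "K * exp (- c * t) \<le> C * exp (- c * t)"
      by (simp add: C_def)
    then show ?thesis using decay[OF True] by linarith
  next
    case False
    then have "f t \<le> M * 1" using M[of t] that by auto
    also have "\<dots> \<le> M * exp (c * a - c * t)"
      using False \<open>c \<ge> 0\<close> \<open>M > 0\<close> by (simp add: mult_left_mono)
    also have "\<dots> = M * exp (c * a) * exp (- c * t)"
      by (simp add: exp_diff exp_minus field_simps)
    also have "\<dots> \<le> C * exp (- c * t)"
      by (simp add: C_def)
    finally show ?thesis .
  qed
  moreover have "C \<ge> 0" using \<open>K \<ge> 0\<close> by (simp add: C_def)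
  ultimately show ?thesis by blast
qed

text \<open>The derivative is taken within \<open>S\<close> so that the rule also covers time 0,
  where a trajectory is differentiable from the right only.\<close>

lemma GDERIV_chain_vector_derivative:
  assumes "GDERIV h (x t) :> g" "(x has_vector_derivative v) (at t within S)"
  shows "((\<lambda>t. h (x t)) has_real_derivative g \<bullet> v) (at t within S)"
proof -
  have "((\<lambda>t. h (x t)) has_derivative (\<lambda>s. (s *\<^sub>R v) \<bullet> g)) (at t within S)"
    by (rule has_derivative_compose[of x _ t S h "\<lambda>u. u \<bullet> g"])
       (use assms in \<open>auto simp: has_vector_derivative_def gderiv_def\<close>)
  then show ?thesis
    by (simp add: has_field_derivative_def inner_commute mult_commute_abs)
qed

lemma inner_has_real_derivative:
  assumes "(f has_vector_derivative f') (at t within S)"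
    and "(g has_vector_derivative g') (at t within S)"
  shows "((\<lambda>t. f t \<bullet> g t) has_real_derivative f t \<bullet> g' + f' \<bullet> g t) (at t within S)"
proof -
  have "((\<lambda>t. f t \<bullet> g t) has_derivative (\<lambda>s. f t \<bullet> (s *\<^sub>R g') + (s *\<^sub>R f') \<bullet> g t)) (at t within S)"
    using assms unfolding has_vector_derivative_def by (rule has_derivative_inner)
  moreover have "(\<lambda>s. f t \<bullet> (s *\<^sub>R g') + (s *\<^sub>R f') \<bullet> g t) = (*) (f t \<bullet> g' + f' \<bullet> g t)"
    by (auto simp: algebra_simps)
  ultimately show ?thesis
    by (simp add: has_field_derivative_def)
qed

text \<open>The mechanical energy \<open>H + (v \<bullet> v) / 2\<close> dissipates only through the
  velocity; the cross term adds dissipation through \<open>y\<close>. The last weight is chosen to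
  cancel the \<langle>y, v\<rangle> terms in the derivative and is large enough to absorb the cross
  term.\<close>

definition lyapunov :: "real \<Rightarrow> real \<Rightarrow> 'a::real_inner \<Rightarrow> 'a \<Rightarrow> real" where
  "lyapunov \<alpha> H y v = H + (v \<bullet> v) / 2 + \<alpha> / 2 * (y \<bullet> v) + \<alpha>\<^sup>2 / 4 * (y \<bullet> y)"

text \<open>Completing the square: the terms other than \<open>H\<close> equal |v + (\<alpha>/2)
  y|^2 / 2 + (\<alpha>^2/8) |y|^2.\<close>

lemma lyapunov_lower: "H \<le> lyapunov \<alpha> H y v"
proof -
  have "0 \<le> ((v + (\<alpha> / 2) *\<^sub>R y) \<bullet> (v + (\<alpha> / 2) *\<^sub>R y)) / 2 + \<alpha>\<^sup>2 / 8 * (y \<bullet> y)"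
    by simp
  also have "\<dots> = lyapunov \<alpha> H y v - H"
    by (simp add: lyapunov_def inner_add_left inner_add_right inner_commute power2_eq_square
        field_simps)
  finally show ?thesis by simp
qed

text \<open>Young's inequality splits the cross term into squares, and the growth bound then trades
  |y|^2 for (8/\<gamma>) H.\<close>

lemma lyapunov_upper:
  assumes "\<alpha> > 0" "\<gamma> > 0" "\<gamma> / 8 * (y \<bullet> y) \<le> H"
  shows "lyapunov \<alpha> H y v \<le> (1 + (2 * \<alpha> + 2 * \<alpha>\<^sup>2) / \<gamma>) * H + (1 / 2 + \<alpha> / 4) * (v \<bullet> v)"
proof -
  have "0 \<le> (y - v) \<bullet> (y - v)" by simp
  then have "y \<bullet> v \<le> (y \<bullet> y + v \<bullet> v) / 2"
    by (simp add: inner_diff_left inner_diff_right inner_commute)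
  then have "\<alpha> / 2 * (y \<bullet> v) \<le> \<alpha> / 2 * ((y \<bullet> y + v \<bullet> v) / 2)"
    using \<open>\<alpha> > 0\<close> by (intro mult_left_mono) auto
  then have "lyapunov \<alpha> H y v
      \<le> H + (\<alpha> / 4 + \<alpha>\<^sup>2 / 4) * (y \<bullet> y) + (1 / 2 + \<alpha> / 4) * (v \<bullet> v)"
    by (simp add: lyapunov_def algebra_simps)
  moreover have "(\<alpha> / 4 + \<alpha>\<^sup>2 / 4) * (y \<bullet> y) \<le> (\<alpha> / 4 + \<alpha>\<^sup>2 / 4) * (8 / \<gamma> * H)"
    using assms by (intro mult_left_mono) (auto simp: field_simps)
  moreover have "(\<alpha> / 4 + \<alpha>\<^sup>2 / 4) * (8 / \<gamma> * H) = (2 * \<alpha> + 2 * \<alpha>\<^sup>2) / \<gamma> * H"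
    using \<open>\<gamma> > 0\<close> by (simp add: field_simps)
  ultimately show ?thesis unfolding distrib_right[of 1] mult_1 by linarith
qed

text \<open>After the equation is solved for \<open>a\<close>, the power terms \<langle>g,
  v\<rangle> of potential and kinetic energy cancel, as do the \<langle>y, v\<rangle> terms for y =
  x - z. Friction gives -\<alpha> |v|^2, of which the cross term returns half.\<close>

lemma lyapunov_has_real_derivative:
  assumes "GDERIV h (x t) :> g" "(x has_vector_derivative v t) (at t)"
    and "(v has_vector_derivative a) (at t)" "a + \<alpha> *\<^sub>R v t + g = 0"
  shows "((\<lambda>t. lyapunov \<alpha> (h (x t) - m) (x t - z) (v t)) has_real_derivative
      - (\<alpha> / 2) * (v t \<bullet> v t + g \<bullet> (x t - z))) (at t)"
proof -
  have a: "a = - (\<alpha> *\<^sub>R v t) - g"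
    using assms(4) by (simp add: algebra_simps eq_neg_iff_add_eq_0)
  have y: "((\<lambda>t. x t - z) has_vector_derivative v t) (at t)"
    using assms(2) by (auto intro!: derivative_eq_intros)
  have "((\<lambda>t. lyapunov \<alpha> (h (x t) - m) (x t - z) (v t)) has_real_derivative
      (g \<bullet> v t - 0) + (v t \<bullet> a + a \<bullet> v t) / 2 + \<alpha> / 2 * ((x t - z) \<bullet> a + v t \<bullet> v t)
        + \<alpha>\<^sup>2 / 4 * ((x t - z) \<bullet> v t + v t \<bullet> (x t - z))) (at t)"
    unfolding lyapunov_def
    by (intro DERIV_add DERIV_diff DERIV_const DERIV_cdivide DERIV_cmult
        GDERIV_chain_vector_derivative inner_has_real_derivative y assms(1-3))
  also have "(g \<bullet> v t - 0) + (v t \<bullet> a + a \<bullet> v t) / 2 + \<alpha> / 2 * ((x t - z) \<bullet> a + v t \<bullet> v t)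
        + \<alpha>\<^sup>2 / 4 * ((x t - z) \<bullet> v t + v t \<bullet> (x t - z))
      = - (\<alpha> / 2) * (v t \<bullet> v t + g \<bullet> (x t - z))"
    by (simp add: a inner_diff_left inner_diff_right inner_commute power2_eq_square field_simps)
  finally show ?thesis .
qed

theorem theorem23:
  fixes h :: "real ^ 'n \<Rightarrow> real"
    and xbar x\<^sub>0 v\<^sub>0 :: "real ^ 'n"
    and \<alpha> \<gamma> :: real
  assumes "\<forall>z. h differentiable (at z)"
    and "\<gamma> > 0"
    and "strongly_quasiconvex \<gamma> h"
    and "{z. is_arg_min h (\<lambda>_. True) z} = {xbar}"
    and "\<alpha> > 0"
    and "\<exists>\<kappa>>0. \<forall>x. trajectory \<alpha> h x\<^sub>0 v\<^sub>0 x \<longrightarrow>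
           (\<forall>t\<ge>0. grad h (x t) \<bullet> (x t - xbar) \<ge> \<kappa> * (h (x t) - h xbar))"
  shows "\<forall>x. trajectory \<alpha> h x\<^sub>0 v\<^sub>0 x \<longrightarrow>
           (\<exists>C\<ge>0. \<exists>c>0. \<forall>t\<ge>0. norm (x t - xbar) \<le> C * exp (- c * t)) \<and>
           (\<exists>C\<ge>0. \<exists>c>0. \<forall>t\<ge>0. h (x t) - h xbar \<le> C * exp (- c * t))"
proof (intro allI impI)
  fix x assume traj: "trajectory \<alpha> h x\<^sub>0 v\<^sub>0 x"
  obtain \<kappa> where "\<kappa> > 0"
    and \<kappa>: "\<And>t. t \<ge> 0 \<Longrightarrow> grad h (x t) \<bullet> (x t - xbar) \<ge> \<kappa> * (h (x t) - h xbar)"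
    using assms(6) traj by blast
  obtain v a where x': "\<And>t. t \<ge> 0 \<Longrightarrow> (x has_vector_derivative v t) (at t within {0..})"
    and v': "\<And>t. t > 0 \<Longrightarrow> (v has_vector_derivative a t) (at t)"
    and ode: "\<And>t. t > 0 \<Longrightarrow> a t + \<alpha> *\<^sub>R v t + grad h (x t) = 0"
    using traj unfolding trajectory_def by blast
  have min: "h xbar \<le> h z" for z
    using assms(4) by (auto simp: set_eq_iff is_arg_min_linorder)
  define H where "H t = h (x t) - h xbar" for t
  define E where "E t = lyapunov \<alpha> (H t) (x t - xbar) (v t)" for t
  define A where "A = 1 + (2 * \<alpha> + 2 * \<alpha>\<^sup>2) / \<gamma>"
  define B where "B = 1 / 2 + \<alpha> / 4"
  \<comment> \<open>The largest rate with c A \<le> \<alpha> \<kappa>/2 and c B \<le> \<alpha>/2, so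
    that the upper bound for c E is matched term by term with the dissipation.\<close>
  define c where "c = min (\<alpha> / 2 * \<kappa> / A) (\<alpha> / 2 / B)"
  have "A > 0" "B > 0"
    using \<open>\<alpha> > 0\<close> \<open>\<gamma> > 0\<close> by (auto simp: A_def B_def add_pos_nonneg)
  then have "c > 0"
    using \<open>\<alpha> > 0\<close> \<open>\<kappa> > 0\<close> by (simp add: c_def)
  have "c \<le> \<alpha> / 2 * \<kappa> / A" "c \<le> \<alpha> / 2 / B"
    by (simp_all add: c_def)
  then have cA: "c * A \<le> \<alpha> / 2 * \<kappa>" and cB: "c * B \<le> \<alpha> / 2"
    using \<open>A > 0\<close> \<open>B > 0\<close> by (simp_all add: pos_le_divide_eq)
  have H_nonneg: "H t \<ge> 0" for t
    by (simp add: H_def min)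
  have growth: "\<gamma> / 8 * (norm (x t - xbar))\<^sup>2 \<le> H t" for t
    unfolding H_def by (rule strongly_quasiconvex_quadratic_growth[OF assms(3) min])
  have x'': "(x has_vector_derivative v t) (at t)" if "t > 0" for t
  proof -
    have "at t within {0..} = at t"
      using that by (intro at_within_open_subset[of t "{0<..}"]) auto
    then show ?thesis using x'[of t] that by simp
  qed
  have E': "(E has_real_derivative
      - (\<alpha> / 2) * (v t \<bullet> v t + grad h (x t) \<bullet> (x t - xbar))) (at t)" if "t > 0" for t
    unfolding E_def H_def
    by (rule lyapunov_has_real_derivative[OF GDERIV_grad x'' v' ode]) (use that assms(1) in auto)
  have E'_le: "- (\<alpha> / 2) * (v t \<bullet> v t + grad h (x t) \<bullet> (x t - xbar)) \<le> - c * E t"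
    if "t > 0" for t
  proof -
    have "E t \<le> A * H t + B * (v t \<bullet> v t)"
      unfolding E_def A_def B_def
      using growth[of t] by (intro lyapunov_upper assms) (simp add: power2_norm_eq_inner)
    then have "c * E t \<le> c * (A * H t + B * (v t \<bullet> v t))"
      using \<open>c > 0\<close> by simp
    also have "\<dots> = (c * A) * H t + (c * B) * (v t \<bullet> v t)"
      by (simp add: algebra_simps)
    also have "\<dots> \<le> (\<alpha> / 2 * \<kappa>) * H t + (\<alpha> / 2) * (v t \<bullet> v t)"
      by (intro add_mono mult_right_mono cA cB H_nonneg) auto
    also have "\<dots> = \<alpha> / 2 * (v t \<bullet> v t + \<kappa> * H t)"
      by (simp add: algebra_simps)
    \<comment> \<open>The assumed inequality with \<kappa> enters here, turning decay in terms of
      \<open>H\<close> into decay in terms of the gradient.\<close>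
    also have "\<dots> \<le> \<alpha> / 2 * (v t \<bullet> v t + grad h (x t) \<bullet> (x t - xbar))"
      using \<kappa>[of t] that \<open>\<alpha> > 0\<close> by (intro mult_left_mono) (auto simp: H_def)
    finally show ?thesis by simp
  qed
  have H_le_E: "H t \<le> E t" for t
    unfolding E_def by (rule lyapunov_lower)
  \<comment> \<open>The decay estimate starts at time 1 because \<open>v\<close> need not be continuous at time 0.\<close>
  have "H t \<le> E 1 * exp (c * 1) * exp (- c * t)" if "t \<ge> 1" for t
    using differential_inequality_exp_decay[OF E' E'_le, of 1 t] that H_le_E[of t] by simp
  moreover have "E 1 * exp (c * 1) \<ge> 0"
    using H_nonneg[of 1] H_le_E[of 1] by simp
  \<comment> \<open>Unlike \<open>E\<close>, \<open>H\<close> involves only the position, which is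
    continuous up to time 0 by its one-sided derivative there. The decay is therefore extended to
    \<open>{0..1}\<close> for \<open>H\<close>.\<close>
  moreover have "continuous_on {0..1} H"
  proof (rule continuous_on_subset[of "{0..}"])
    have "((\<lambda>t. h (x t)) has_real_derivative grad h (x t) \<bullet> v t) (at t within {0..})"
      if "t \<ge> 0" for t
      by (rule GDERIV_chain_vector_derivative[OF GDERIV_grad x']) (use that assms(1) in auto)
    then have "continuous_on {0..} (\<lambda>t. h (x t))"
      by (intro DERIV_continuous_on) auto
    then show "continuous_on {0..} H"
      unfolding H_def by (intro continuous_intros)
  qed auto
  ultimately obtain C where "C \<ge> 0" and C: "\<And>t. t \<ge> 0 \<Longrightarrow> H t \<le> C * exp (- c * t)"
    using exp_decay_extend_to_zero[of 1 H c "E 1 * exp (c * 1)"] \<open>c > 0\<close> by auto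
  \<comment> \<open>Square root of the growth bound combined with the decay of \<open>H\<close>;
    this halves the rate.\<close>
  have "norm (x t - xbar) \<le> sqrt (8 * C / \<gamma>) * exp (- (c / 2) * t)" if "t \<ge> 0" for t
  proof (rule power2_le_imp_le)
    have "\<gamma> / 8 * (norm (x t - xbar))\<^sup>2 \<le> C * exp (- c * t)"
      using growth[of t] C[OF that] by linarith
    then have "(norm (x t - xbar))\<^sup>2 \<le> 8 * C / \<gamma> * exp (- c * t)"
      using \<open>\<gamma> > 0\<close> by (simp add: field_simps)
    also have "\<dots> = (sqrt (8 * C / \<gamma>) * exp (- (c / 2) * t))\<^sup>2"
      using \<open>C \<ge> 0\<close> \<open>\<gamma> > 0\<close> by (simp add: power_mult_distrib exp_double[symmetric])
    finally show "(norm (x t - xbar))\<^sup>2 \<le> (sqrt (8 * C / \<gamma>) * exp (- (c / 2) * t))\<^sup>2" .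
  qed (use \<open>C \<ge> 0\<close> \<open>\<gamma> > 0\<close> in auto)
  moreover have "sqrt (8 * C / \<gamma>) \<ge> 0"
    using \<open>C \<ge> 0\<close> \<open>\<gamma> > 0\<close> by simp
  ultimately have "\<exists>C\<ge>0. \<exists>c>0. \<forall>t\<ge>0. norm (x t - xbar) \<le> C * exp (- c * t)"
    using \<open>c > 0\<close> half_gt_zero[OF \<open>c > 0\<close>] by blast
  moreover have "\<exists>C\<ge>0. \<exists>c>0. \<forall>t\<ge>0. h (x t) - h xbar \<le> C * exp (- c * t)"
    using C \<open>C \<ge> 0\<close> \<open>c > 0\<close> unfolding H_def by blast
  ultimately show "(\<exists>C\<ge>0. \<exists>c>0. \<forall>t\<ge>0. norm (x t - xbar) \<le> C * exp (- c * t)) \<and>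
      (\<exists>C\<ge>0. \<exists>c>0. \<forall>t\<ge>0. h (x t) - h xbar \<le> C * exp (- c * t))" ..
qed

end
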